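(* Let $a_1,\ldots,a_n$ be nonnegative integers, let $I=\{i_1,i_2,\ldots,i_{2m}\}$ be a $2m$-element subset of $\{1,2,\ldots,n\}$, and let $r\leq n$ be a positive integer with $r\notin I$. Then $$\mathrm{CT}_{\mathbf{x}}\ \frac{\big(\sum_{j=1}^{2m}(-1)^jx_{i_j}\big)^2}{x_r^2}D_n(\mathbf{x},\mathbf{a})=-\frac{a_r(a+1)}{2+a^{(r)}}\sum_{j\in I}\frac{1}{1+a^{(r)}-a_j}\,C_n(\mathbf{a}).$$
   Context: For nonnegative integers $a_1,\ldots,a_n$, write $\mathbf{a}=(a_1,\ldots,a_n)$ and $\mathbf{x}=(x_1,\ldots,x_n)$ (indeterminates). The Dyson product is the Laurent polynomial $D_n(\mathbf{x},\mathbf{a}):=\prod_{1\le i\ne j\le n}\left(1-\frac{x_i}{x_j}\right)^{a_i}$ (product over all ordered pairs $(i,j)$ with $i\neq j$). $\mathrm{CT}_{\mathbf{x}}f(\mathbf{x})$ denotes the constant term of the Laurent polynomial $f$ in the variables $x_1,\ldots,x_n$, i.e. the coefficient of $x_1^0\cdots x_n^0$. Set $a:=a_1+a_2+\cdots+a_n$, $a^{(j)}:=a-a_j$, and $C_n(\mathbf{a}):=\frac{(a_1+a_2+\cdots+a_n)!}{a_1!\,a_2!\cdots a_n!}$. *)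

theory Defs
  imports Complex_Main "HOL-Library.Poly_Mapping"
begin

text \<open>
  Laurent polynomials with rational coefficients, as the group ring of the additive group of
  finitely supported exponent vectors: such a polynomial maps each exponent vector to its
  coefficient, and the product of \<open>Poly_Mapping\<close> is the convolution product.
  The variables are indexed by all naturals; only those with index in
  \<open>{1..n}\<close> occur in the objects below, so the constant term is that in \<open>x\<^sub>1, \<dots>, x\<^sub>n\<close>.
\<close>

type_synonym laurent = "(nat \<Rightarrow>\<^sub>0 int) \<Rightarrow>\<^sub>0 rat"

definition X :: "nat \<Rightarrow> laurent" where
  "X i = Poly_Mapping.single (Poly_Mapping.single i 1) 1"

definition X_inv :: "nat \<Rightarrow> laurent" where
  "X_inv i = Poly_Mapping.single (Poly_Mapping.single i (-1)) 1"

lemma X_mult_X_inv: "X i * X_inv i = 1"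
  by (simp add: X_def X_inv_def mult_single flip: single_add)

definition CT :: "laurent \<Rightarrow> rat" where
  "CT f = Poly_Mapping.lookup f 0"

definition dyson_product :: "nat \<Rightarrow> (nat \<Rightarrow> nat) \<Rightarrow> laurent" where
  "dyson_product n a =
     (\<Prod>(i, j) \<in> {(i, j). i \<in> {1..n} \<and> j \<in> {1..n} \<and> i \<noteq> j}. (1 - X i * X_inv j) ^ a i)"

definition dyson_const :: "nat \<Rightarrow> (nat \<Rightarrow> nat) \<Rightarrow> rat" where
  "dyson_const n a = fact (\<Sum>i = 1..n. a i) / (\<Prod>i = 1..n. fact (a i))"

definition total_exp :: "nat \<Rightarrow> (nat \<Rightarrow> nat) \<Rightarrow> rat" where
  "total_exp n a = of_nat (\<Sum>i = 1..n. a i)"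

definition total_except :: "nat \<Rightarrow> (nat \<Rightarrow> nat) \<Rightarrow> nat \<Rightarrow> rat" where
  "total_except n a j = total_exp n a - of_nat (a j)"

end

theory Submission
  imports Defs "HOL-Computational_Algebra.Polynomial"
begin

text \<open>
  Expanding the square reduces the theorem to the constant terms of \<open>x\<^sub>s x\<^sub>t / x\<^sub>r\<^sup>2\<close> times the Dyson
  product \<open>D(a)\<close>, with \<open>s\<close> and \<open>t\<close> different from \<open>r\<close>. They are evaluated by Good's method.

  If all exponents are positive, Lagrange interpolation of the constant 1 (\<open>good_identity\<close>) gives
  \<open>D(a) = \<Sum>\<^sub>k D(a - e\<^sub>k)\<close> with \<open>e\<^sub>k\<close> the unit vectors (\<open>dyson_recursion\<close>). If \<open>a\<^sub>k = 0\<close>, then \<open>D(a)\<close> is a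
  polynomial in \<open>1 / x\<^sub>k\<close>, namely the Dyson product of the remaining variables times
  \<open>\<Prod>\<^sub>i (1 - x\<^sub>i / x\<^sub>k)\<close> with exponents \<open>a\<^sub>i\<close>. Only the coefficients of its expansion up to order two
  can meet the monomial in front (\<open>CT_drop\<close>, \<open>CT_drop_X\<close>, \<open>CT_drop_X_X\<close>), and they turn the constant
  term into a combination of constant terms of the same kind in fewer variables. The monomials
  \<open>1\<close>, \<open>x\<^sub>s / x\<^sub>r\<close> and \<open>x\<^sub>s x\<^sub>t / x\<^sub>r\<^sup>2\<close> are closed under this process, so a formula for their constant
  terms is proved as soon as it satisfies the same recursion and the same reduction.

  Let \<open>C\<close> be the multinomial coefficient, \<open>b\<close> the sum of the exponents other than \<open>a\<^sub>r\<close>,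
  \<open>K = a\<^sub>r (a\<^sub>r + b + 1) / (2 + b)\<close> and \<open>w\<^sub>i = 1 / (1 + b - a\<^sub>i)\<close>. The three constant terms are \<open>C\<close>
  (Dyson's conjecture, \<open>CT_dyson\<close>), \<open>- a\<^sub>r / (1 + b) C\<close> (\<open>CT_dyson_linear_ratio\<close>), and
  \<open>(f + K w\<^sub>s + K w\<^sub>t) C\<close> for \<open>s \<noteq> t\<close> but \<open>(f + K w\<^sub>s) C\<close> for \<open>s = t\<close>
  (\<open>CT_dyson_quadratic_ratio\<close>), with one \<open>f\<close> for all \<open>s\<close> and \<open>t\<close>
  (\<open>quadratic_ratio_eq_base\<close>). Since the \<open>2m\<close> alternating signs add up to zero, the additive part
  \<open>f + K w\<^sub>s + K w\<^sub>t\<close> cancels in the expanded square, and the defect \<open>- K w\<^sub>s\<close> of the diagonal terms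
  remains: this is the claimed sum.
\<close>

section \<open>Good's interpolation identity\<close>

text \<open>
  Lagrange interpolation of the constant polynomial 1 at the nodes \<open>x i\<close>, evaluated at 0 and cleared
  of the denominators \<open>y i\<close>. It holds because the polynomial \<open>p\<close> below has degree less than
  \<open>card S\<close> and takes the value \<open>\<Prod>i\<in>S. y i\<close> at every node. Clearing denominators and writing \<open>u i\<close>
  for \<open>1 / x i\<close> lets the identity be used in the ring of Laurent polynomials itself.
\<close>

lemma good_identity:
  fixes x u :: "'i \<Rightarrow> 'a::idom"
  assumes fin: "finite S" and ne: "S \<noteq> {}" and inj: "inj_on x S"
    and inv: "\<And>i. i \<in> S \<Longrightarrow> x i * u i = 1"
  defines "y \<equiv> \<lambda>i. \<Prod>j\<in>S - {i}. 1 - x i * u j"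
  shows "(\<Sum>k\<in>S. \<Prod>i\<in>S - {k}. y i) = (\<Prod>i\<in>S. y i)"
proof -
  \<comment> \<open>The interpolation polynomial in the basis of nodal products; at \<open>x l\<close> only \<open>k = l\<close> survives.\<close>
  define p where "p = (\<Sum>k\<in>S. smult (\<Prod>i\<in>S - {k}. y i) (\<Prod>j\<in>S - {k}. [:1, - u j:]))"
  have "p = [:\<Prod>i\<in>S. y i:]"
  proof (rule poly_eqI_degree)
    fix z assume "z \<in> x ` S"
    then obtain l where l: "l \<in> S" and z: "z = x l" by blast
    have vanish: "(\<Prod>j\<in>S - {k}. 1 - x l * u j) = 0" if "k \<in> S" "k \<noteq> l" for k
      using that l fin inv[OF l] by (intro prod_zero) auto
    have "poly p z = (\<Sum>k\<in>S. (\<Prod>i\<in>S - {k}. y i) * (\<Prod>j\<in>S - {k}. 1 - x l * u j))"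
      by (simp add: p_def poly_sum poly_prod z)
    also have "\<dots> = (\<Sum>k\<in>{l}. (\<Prod>i\<in>S - {k}. y i) * (\<Prod>j\<in>S - {k}. 1 - x l * u j))"
      using fin l vanish by (intro sum.mono_neutral_right) auto
    also have "\<dots> = (\<Prod>i\<in>S. y i)"
      using fin l by (simp add: prod.remove[of S l] y_def mult.commute)
    finally show "poly p z = poly [:\<Prod>i\<in>S. y i:] z" by simp
  next
    have "degree (smult (\<Prod>i\<in>S - {k}. y i) (\<Prod>j\<in>S - {k}. [:1, - u j:])) \<le> card S - 1"
      if "k \<in> S" for k
    proof -
      have "degree (\<Prod>j\<in>S - {k}. [:1, - u j:]) \<le> (\<Sum>j\<in>S - {k}. degree [:1, - u j:])"
        using degree_prod_sum_le[of "S - {k}" "\<lambda>j. [:1, - u j:]"] fin by (simp add: o_def)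
      also have "\<dots> \<le> (\<Sum>j\<in>S - {k}. 1)" by (intro sum_mono) auto
      finally show ?thesis
        using that fin by (intro order.trans[OF degree_smult_le]) simp
    qed
    then have "degree p \<le> card S - 1"
      unfolding p_def by (intro degree_sum_le fin)
    moreover have "card S > 0" using fin ne by (simp add: card_gt_0_iff)
    ultimately show "card (x ` S) > degree p" using inj by (simp add: card_image)
    show "card (x ` S) > degree [:\<Prod>i\<in>S. y i:]" using \<open>card S > 0\<close> inj by (simp add: card_image)
  qed
  then have "poly p 0 = (\<Prod>i\<in>S. y i)" by simp
  then show ?thesis by (simp add: p_def poly_sum poly_prod)
qed

section \<open>Dyson products and their recursion\<close>

text \<open>
  The index set is an arbitrary set, since the induction removes indices one at a time.
\<close>

definition dyson :: "nat set \<Rightarrow> (nat \<Rightarrow> nat) \<Rightarrow> laurent" where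
  "dyson S a = (\<Prod>i\<in>S. (\<Prod>j\<in>S - {i}. 1 - X i * X_inv j) ^ a i)"

lemma dyson_product_eq_dyson: "dyson_product n a = dyson {1..n} a"
proof -
  have "{(i, j). i \<in> {1..n} \<and> j \<in> {1..n} \<and> i \<noteq> j} = Sigma {1..n} (\<lambda>i. {1..n} - {i})"
    by auto
  moreover have "(\<Prod>i\<in>{1..n}. \<Prod>j\<in>{1..n} - {i}. (1 - X i * X_inv j) ^ a i)
      = (\<Prod>(i, j)\<in>Sigma {1..n} (\<lambda>i. {1..n} - {i}). (1 - X i * X_inv j) ^ a i)"
    by (rule prod.Sigma) auto
  ultimately show ?thesis
    unfolding dyson_product_def dyson_def by (simp only: prod_power_distrib)
qed

lemma X_eq_iff: "X i = X j \<longleftrightarrow> i = j"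
proof
  assume "X i = X j"
  then have "Poly_Mapping.keys (X i) = Poly_Mapping.keys (X j)" by simp
  then have "Poly_Mapping.single i (1::int) = Poly_Mapping.single j 1"
    by (simp add: X_def)
  then have "Poly_Mapping.keys (Poly_Mapping.single i (1::int)) = Poly_Mapping.keys (Poly_Mapping.single j (1::int))" by simp
  then show "i = j" by simp
qed simp

text \<open>
  Good's recursion: with the common factor \<open>M\<close> (all exponents lowered by one) taken out, it is the
  interpolation identity for the nodes \<open>X i\<close>.
\<close>

lemma dyson_recursion:
  assumes fin: "finite S" and ne: "S \<noteq> {}" and pos: "\<And>i. i \<in> S \<Longrightarrow> a i > 0"
  shows "(\<Sum>k\<in>S. dyson S (a(k := a k - 1))) = dyson S a"
proof -
  define y where "y = (\<lambda>i. \<Prod>j\<in>S - {i}. 1 - X i * X_inv j)"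
  define M where "M = (\<Prod>i\<in>S. y i ^ (a i - 1))"
  have step: "dyson S (a(k := a k - 1)) = M * (\<Prod>i\<in>S - {k}. y i)" if k: "k \<in> S" for k
  proof -
    have "dyson S (a(k := a k - 1)) = y k ^ (a k - 1) * (\<Prod>i\<in>S - {k}. y i ^ a i)"
      unfolding dyson_def y_def using fin k by (subst prod.remove[of S k]) (auto intro!: prod.cong)
    also have "(\<Prod>i\<in>S - {k}. y i ^ a i) = (\<Prod>i\<in>S - {k}. y i ^ (a i - 1) * y i)"
      using pos by (intro prod.cong refl power_minus_mult[symmetric]) auto
    finally show ?thesis
      unfolding M_def using fin k by (subst prod.remove[of S k]) (simp_all add: prod.distrib mult_ac fun_upd_def)
  qed
  have "dyson S a = (\<Prod>i\<in>S. y i ^ (a i - 1) * y i)"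
    unfolding dyson_def y_def using pos by (intro prod.cong refl power_minus_mult[symmetric]) auto
  then have "dyson S a = M * (\<Prod>i\<in>S. y i)" by (simp add: M_def prod.distrib)
  also have "(\<Prod>i\<in>S. y i) = (\<Sum>k\<in>S. \<Prod>i\<in>S - {k}. y i)"
    unfolding y_def using fin ne
    by (intro good_identity[symmetric]) (auto simp: inj_on_def X_eq_iff X_mult_X_inv)
  finally show ?thesis by (simp add: step sum_distrib_left del: One_nat_def)
qed

text \<open>
  A vanishing exponent at \<open>k\<close> leaves only nonpositive powers of the variable \<open>k\<close>, all of them in
  one explicit factor.
\<close>

lemma dyson_remove:
  assumes fin: "finite S" and k: "k \<in> S" and "a k = 0"
  shows "dyson S a = dyson (S - {k}) a * (\<Prod>i\<in>S - {k}. (1 - X i * X_inv k) ^ a i)"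
proof -
  have "dyson S a = (\<Prod>i\<in>S - {k}. (\<Prod>j\<in>S - {i}. 1 - X i * X_inv j) ^ a i)"
    unfolding dyson_def using assms by (subst prod.remove[of S k]) auto
  also have "\<dots> = (\<Prod>i\<in>S - {k}. ((1 - X i * X_inv k) * (\<Prod>j\<in>S - {k} - {i}. 1 - X i * X_inv j)) ^ a i)"
  proof (rule prod.cong[OF refl])
    fix i assume "i \<in> S - {k}"
    then have "S - {i} - {k} = S - {k} - {i}" "k \<in> S - {i}" using k by auto
    then show "(\<Prod>j\<in>S - {i}. 1 - X i * X_inv j) ^ a i
      = ((1 - X i * X_inv k) * (\<Prod>j\<in>S - {k} - {i}. 1 - X i * X_inv j)) ^ a i"
      using fin prod.remove[of "S - {i}" k "\<lambda>j. 1 - X i * X_inv j"] by simp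
  qed
  finally show ?thesis by (simp add: dyson_def power_mult_distrib prod.distrib mult.commute)
qed

text \<open>
  The induction scheme of all three evaluations: either every exponent is positive and Good's
  recursion applies, or some exponent is zero and its index can be dropped. Both steps lower
  \<open>card S + sum a S\<close>.
\<close>

lemma dyson_induct [consumes 1, case_names empty drop decrease]:
  fixes a :: "'i \<Rightarrow> nat"
  assumes "finite S"
    and empty: "\<And>a. P {} a"
    and drop: "\<And>S a k. finite S \<Longrightarrow> k \<in> S \<Longrightarrow> a k = 0 \<Longrightarrow> P (S - {k}) a \<Longrightarrow> P S a"
    and decrease: "\<And>S a. finite S \<Longrightarrow> S \<noteq> {} \<Longrightarrow> (\<And>i. i \<in> S \<Longrightarrow> a i > 0) \<Longrightarrow>
      (\<And>k. k \<in> S \<Longrightarrow> P S (a(k := a k - 1))) \<Longrightarrow> P S a"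
  shows "P S a"
  using \<open>finite S\<close>
proof (induction "card S + sum a S" arbitrary: S a rule: less_induct)
  case less
  consider "S = {}" | k where "k \<in> S" "a k = 0" | "S \<noteq> {}" "\<And>i. i \<in> S \<Longrightarrow> a i > 0" by blast
  then show ?case
  proof cases
    case 1 then show ?thesis by (simp add: empty)
  next
    case 2
    have "card (S - {k}) < card S"
      using less.prems 2(1) by (rule card_Diff1_less)
    moreover have "sum a (S - {k}) \<le> sum a S"
      using less.prems by (intro sum_mono2) auto
    ultimately have "P (S - {k}) a"
      using less.prems by (intro less.hyps) simp_all
    then show ?thesis by (intro drop[of S k a] less.prems 2)
  next
    case 3
    have "P S (a(k := a k - 1))" if "k \<in> S" for k
    proof (rule less.hyps)
      have "sum (a(k := a k - 1)) S < sum a S"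
        using that 3(2) less.prems by (intro sum_strict_mono_ex1) auto
      then show "card S + sum (a(k := a k - 1)) S < card S + sum a S" by simp
    qed (rule less.prems)
    with less.prems 3 show ?thesis by (rule decrease[of S a])
  qed
qed

section \<open>Exponents of one variable and vanishing constant terms\<close>

lemma CT_add: "CT (f + g) = CT f + CT g"
  and CT_diff: "CT (f - g) = CT f - CT g"
  and CT_uminus: "CT (- f) = - CT f"
  and CT_sum: "CT (\<Sum>i\<in>A. h i) = (\<Sum>i\<in>A. CT (h i))"
  by (simp_all add: CT_def lookup_add lookup_minus lookup_sum)

lemma CT_of_nat_mult: "CT (of_nat c * f) = of_nat c * CT f"
  by (induction c) (simp_all add: CT_add algebra_simps, simp add: CT_def)

lemma CT_numeral_mult: "CT (numeral c * f) = numeral c * CT f"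
  using CT_of_nat_mult[of "numeral c" f] by simp

text \<open>
  \<open>E\<close> collects the exponents with which the variable \<open>k\<close> may occur in \<open>f\<close>. A constant term
  vanishes as soon as \<open>E\<close> misses 0, which is how the terms of higher order are discarded below.
\<close>

definition exps_in :: "nat \<Rightarrow> int set \<Rightarrow> laurent \<Rightarrow> bool" where
  "exps_in k E f \<longleftrightarrow> (\<forall>m\<in>Poly_Mapping.keys f. Poly_Mapping.lookup m k \<in> E)"

lemma CT_eq_0: "exps_in k E f \<Longrightarrow> 0 \<notin> E \<Longrightarrow> CT f = 0"
  unfolding exps_in_def CT_def using in_keys_iff[of 0 f] by auto

lemma exps_in_mono: "exps_in k E f \<Longrightarrow> E \<subseteq> F \<Longrightarrow> exps_in k F f"
  by (auto simp: exps_in_def)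

lemma exps_in_mult:
  assumes "exps_in k E f" "exps_in k F g" "\<And>d e. d \<in> E \<Longrightarrow> e \<in> F \<Longrightarrow> d + e \<in> G"
  shows "exps_in k G (f * g)"
  unfolding exps_in_def
proof
  fix m assume "m \<in> Poly_Mapping.keys (f * g)"
  then obtain d e where "m = d + e" "d \<in> Poly_Mapping.keys f" "e \<in> Poly_Mapping.keys g"
    using keys_mult[of f g] by blast
  with assms show "Poly_Mapping.lookup m k \<in> G" by (simp add: exps_in_def lookup_add)
qed

lemma exps_in_add: "exps_in k E f \<Longrightarrow> exps_in k E g \<Longrightarrow> exps_in k E (f + g)"
  using keys_add[of f g] unfolding exps_in_def by blast

lemma exps_in_uminus: "exps_in k E f \<Longrightarrow> exps_in k E (- f)"
  unfolding exps_in_def by (auto simp: in_keys_iff)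

lemma exps_in_diff: "exps_in k E f \<Longrightarrow> exps_in k E g \<Longrightarrow> exps_in k E (f - g)"
  using exps_in_add[of k E f "- g"] exps_in_uminus by simp

lemma exps_in_0: "exps_in k E 0"
  by (simp add: exps_in_def)

lemma exps_in_1: "0 \<in> E \<Longrightarrow> exps_in k E 1"
  by (simp add: exps_in_def)

lemma exps_in_of_nat: "0 \<in> E \<Longrightarrow> exps_in k E (of_nat c)"
  by (induction c) (auto intro: exps_in_0 exps_in_1 exps_in_add)

lemma exps_in_X: "exps_in k {if i = k then 1 else 0} (X i)"
  and exps_in_X_inv: "exps_in k {if i = k then -1 else 0} (X_inv i)"
  by (auto simp: exps_in_def X_def X_inv_def lookup_single when_def)

lemma exps_in_sum: "(\<And>i. i \<in> A \<Longrightarrow> exps_in k E (h i)) \<Longrightarrow> exps_in k E (\<Sum>i\<in>A. h i)"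
  by (induction A rule: infinite_finite_induct) (auto intro: exps_in_0 exps_in_add)

lemma exps_in_prod:
  assumes "0 \<in> E" "\<And>d e. d \<in> E \<Longrightarrow> e \<in> E \<Longrightarrow> d + e \<in> E"
  shows "(\<And>i. i \<in> A \<Longrightarrow> exps_in k E (h i)) \<Longrightarrow> exps_in k E (\<Prod>i\<in>A. h i)"
proof (induction A rule: infinite_finite_induct)
  case (insert i A)
  then have "exps_in k E (h i * (\<Prod>i\<in>A. h i))"
    by (intro exps_in_mult[of k E _ E]) (use assms in auto)
  with insert show ?case by simp
qed (use assms in \<open>simp_all add: exps_in_1\<close>)

lemma exps_in_power:
  assumes "0 \<in> E" "\<And>d e. d \<in> E \<Longrightarrow> e \<in> E \<Longrightarrow> d + e \<in> E"
  shows "exps_in k E f \<Longrightarrow> exps_in k E (f ^ c)"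
  using exps_in_prod[OF assms, of "{..<c}" k "\<lambda>_. f"] by simp

abbreviation free_of :: "nat \<Rightarrow> laurent \<Rightarrow> bool" where
  "free_of k \<equiv> exps_in k {0}"

abbreviation nonpos_in :: "nat \<Rightarrow> laurent \<Rightarrow> bool" where
  "nonpos_in k \<equiv> exps_in k {..0}"

lemma free_of_X: "i \<noteq> k \<Longrightarrow> free_of k (X i)"
  and free_of_X_inv: "i \<noteq> k \<Longrightarrow> free_of k (X_inv i)"
  using exps_in_X[of k i] exps_in_X_inv[of k i] by simp_all

lemma free_of_mult: "free_of k f \<Longrightarrow> free_of k g \<Longrightarrow> free_of k (f * g)"
  by (erule exps_in_mult) auto

lemma nonpos_in_mult: "nonpos_in k f \<Longrightarrow> nonpos_in k g \<Longrightarrow> nonpos_in k (f * g)"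
  by (erule exps_in_mult) auto

lemma free_of_imp_nonpos_in: "free_of k f \<Longrightarrow> nonpos_in k f"
  by (erule exps_in_mono) auto

lemma nonpos_in_X_inv: "nonpos_in k (X_inv i)"
  using exps_in_X_inv[of k i] by (rule exps_in_mono) auto

lemma free_of_dyson: "k \<notin> S \<Longrightarrow> free_of k (dyson S a)"
  unfolding dyson_def
  by (intro exps_in_prod exps_in_power exps_in_diff exps_in_1 free_of_mult free_of_X free_of_X_inv) auto

lemma CT_nonpos_X_inv: "nonpos_in k f \<Longrightarrow> CT (X_inv k * f) = 0"
  by (rule CT_eq_0[of k "{..-1}"], rule exps_in_mult[OF exps_in_X_inv[of k k]]) auto

lemma CT_free_X: "free_of k f \<Longrightarrow> CT (X k * f) = 0"
  by (rule CT_eq_0[of k "{1}"], rule exps_in_mult[OF exps_in_X[of k k]]) auto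

lemma CT_free_X_X: "free_of k f \<Longrightarrow> CT (X k * X k * f) = 0"
  by (rule CT_eq_0[of k "{2}"], rule exps_in_mult[OF exps_in_mult[OF exps_in_X[of k k] exps_in_X[of k k]]]) auto

lemmas nonpos_in_intros = exps_in_sum exps_in_diff exps_in_add nonpos_in_mult
  exps_in_of_nat nonpos_in_X_inv exps_in_1 exps_in_0

section \<open>Dropping a variable with exponent zero\<close>

text \<open>
  Multiplication by one more factor \<open>1 - x * y\<close> adds \<open>x\<close> to the power sum \<open>p\<close> and \<open>x * x\<close> to the
  power sum \<open>q\<close>; the factor 2 avoids halves in the second elementary symmetric function
  \<open>(p * p - q) / 2\<close>.
\<close>

lemma truncation_step:
  fixes p q x y R :: "'a::comm_ring_1"
  shows "(2 - 2 * p * y + (p * p - q) * y ^ 2 + y ^ 3 * R) * (1 - x * y)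
    = 2 - 2 * (p + x) * y + ((p + x) * (p + x) - (q + x * x)) * y ^ 2
      + y ^ 3 * (R * (1 - x * y) - x * (p * p - q))"
  by (simp add: algebra_simps power2_eq_square power3_eq_cube)

text \<open>
  The expansion in \<open>X_inv k\<close> up to second order. No more is needed because the monomials
  considered contain the variable \<open>k\<close> at most to the second power.
\<close>

lemma prod_expansion:
  fixes a :: "nat \<Rightarrow> nat"
  assumes "finite T" "k \<notin> T"
  defines "P \<equiv> \<lambda>T. \<Sum>i\<in>T. of_nat (a i) * X i"
  defines "Q \<equiv> \<lambda>T. \<Sum>i\<in>T. of_nat (a i) * (X i * X i)"
  shows "\<exists>R. nonpos_in k R \<and> 2 * (\<Prod>i\<in>T. (1 - X i * X_inv k) ^ a i)
    = 2 - 2 * P T * X_inv k + (P T * P T - Q T) * X_inv k ^ 2 + X_inv k ^ 3 * R"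
  using assms(1,2)
proof (induction T rule: finite_induct)
  case empty
  then show ?case by (intro exI[of _ 0]) (simp add: P_def Q_def exps_in_0)
next
  case (insert t T)
  have step: "\<exists>R. nonpos_in k R \<and> 2 * ((\<Prod>i\<in>T. (1 - X i * X_inv k) ^ a i) * (1 - X t * X_inv k) ^ c)
    = 2 - 2 * (P T + of_nat c * X t) * X_inv k
      + ((P T + of_nat c * X t) * (P T + of_nat c * X t) - (Q T + of_nat c * (X t * X t))) * X_inv k ^ 2
      + X_inv k ^ 3 * R" for c
  proof (induction c)
    case 0
    then show ?case using insert by simp
  next
    case (Suc c)
    define p q where "p = P T + of_nat c * X t" and "q = Q T + of_nat c * (X t * X t)"
    obtain R where R: "nonpos_in k R" and
      eq: "2 * ((\<Prod>i\<in>T. (1 - X i * X_inv k) ^ a i) * (1 - X t * X_inv k) ^ c)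
        = 2 - 2 * p * X_inv k + (p * p - q) * X_inv k ^ 2 + X_inv k ^ 3 * R"
      using Suc unfolding p_def q_def by blast
    \<comment> \<open>The coefficient of \<open>X_inv k ^ 3\<close> collects the old remainder and the overflow of the quadratic term.\<close>
    define R' where "R' = R * (1 - X t * X_inv k) - X t * (p * p - q)"
    have "2 * ((\<Prod>i\<in>T. (1 - X i * X_inv k) ^ a i) * (1 - X t * X_inv k) ^ Suc c)
      = (2 - 2 * p * X_inv k + (p * p - q) * X_inv k ^ 2 + X_inv k ^ 3 * R) * (1 - X t * X_inv k)"
      unfolding eq[symmetric] by (simp add: mult_ac)
    also have "\<dots> = 2 - 2 * (p + X t) * X_inv k
        + ((p + X t) * (p + X t) - (q + X t * X t)) * X_inv k ^ 2 + X_inv k ^ 3 * R'"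
      unfolding R'_def by (rule truncation_step)
    also have "p + X t = P T + of_nat (Suc c) * X t" by (simp add: p_def algebra_simps)
    also have "q + X t * X t = Q T + of_nat (Suc c) * (X t * X t)" by (simp add: q_def algebra_simps)
    finally have "2 * ((\<Prod>i\<in>T. (1 - X i * X_inv k) ^ a i) * (1 - X t * X_inv k) ^ Suc c)
      = 2 - 2 * (P T + of_nat (Suc c) * X t) * X_inv k
      + ((P T + of_nat (Suc c) * X t) * (P T + of_nat (Suc c) * X t) - (Q T + of_nat (Suc c) * (X t * X t))) * X_inv k ^ 2
      + X_inv k ^ 3 * R'" .
    moreover have "nonpos_in k R'"
    proof -
      have "nonpos_in k (X i)" if "i \<in> insert t T" for i
        using that insert.prems by (intro free_of_imp_nonpos_in free_of_X) blast
      then have "nonpos_in k (X t)" "\<And>i. i \<in> T \<Longrightarrow> nonpos_in k (X i)" by simp_all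
      then show ?thesis
        unfolding R'_def p_def q_def P_def Q_def
        by (intro nonpos_in_intros R) simp_all
    qed
    ultimately show ?case by blast
  qed
  have "P (insert t T) = P T + of_nat (a t) * X t"
    "Q (insert t T) = Q T + of_nat (a t) * (X t * X t)"
    "(\<Prod>i\<in>insert t T. (1 - X i * X_inv k) ^ a i)
      = (\<Prod>i\<in>T. (1 - X i * X_inv k) ^ a i) * (1 - X t * X_inv k) ^ a t"
    using insert by (simp_all add: P_def Q_def add.commute mult.commute)
  then show ?case using step[of "a t"] by (simp only:)
qed

text \<open>
  If \<open>a k = 0\<close>, the variable \<open>k\<close> can be integrated out: a negative power of it in front finds no
  partner in the expansion above, and the powers 0, 1 and 2 select the coefficient of the opposite
  power.
\<close>

context
  fixes S :: "nat set" and k :: nat and a :: "nat \<Rightarrow> nat" and f :: laurent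
  assumes fin: "finite S" and k: "k \<in> S" and ak: "a k = 0"
begin

lemma CT_drop_X_inv:
  assumes f: "nonpos_in k f"
  shows "CT (X_inv k * f * dyson S a) = 0"
proof -
  have "nonpos_in k (dyson S a)"
    unfolding dyson_remove[of S k a, OF fin k ak]
    by (intro nonpos_in_mult free_of_imp_nonpos_in[OF free_of_dyson] exps_in_prod exps_in_power nonpos_in_intros
        free_of_imp_nonpos_in[OF free_of_X]) simp_all
  then have "CT (X_inv k * (f * dyson S a)) = 0"
    by (intro CT_nonpos_X_inv nonpos_in_mult f)
  then show ?thesis by (simp add: mult_ac)
qed

lemma
  assumes f: "free_of k f"
  shows CT_drop: "CT (f * dyson S a) = CT (f * dyson (S - {k}) a)"
    and CT_drop_X: "CT (X k * f * dyson S a)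
      = - (\<Sum>i\<in>S - {k}. of_nat (a i) * CT (X i * f * dyson (S - {k}) a))"
    and CT_drop_X_X: "2 * CT (X k * X k * f * dyson S a)
      = (\<Sum>i\<in>S - {k}. \<Sum>j\<in>S - {k}. of_nat (a i) * of_nat (a j) * CT (X i * X j * f * dyson (S - {k}) a))
        - (\<Sum>i\<in>S - {k}. of_nat (a i) * CT (X i * X i * f * dyson (S - {k}) a))"
proof -
  define y where "y = X_inv k"
  define P where "P = (\<Sum>i\<in>S - {k}. of_nat (a i) * X i)"
  define Q where "Q = (\<Sum>i\<in>S - {k}. of_nat (a i) * (X i * X i))"
  define F where "F = f * dyson (S - {k}) a"
  obtain R where R: "nonpos_in k R" and
    eq: "2 * (\<Prod>i\<in>S - {k}. (1 - X i * y) ^ a i) = 2 - 2 * P * y + (P * P - Q) * y ^ 2 + y ^ 3 * R"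
    unfolding P_def Q_def y_def using prod_expansion[of "S - {k}" k a] fin by auto
  have D: "2 * (g * f * dyson S a) = F * g * (2 - 2 * P * y + (P * P - Q) * y ^ 2 + y ^ 3 * R)" for g
  proof -
    have "dyson S a = dyson (S - {k}) a * (\<Prod>i\<in>S - {k}. (1 - X i * y) ^ a i)"
      unfolding y_def using fin k ak by (rule dyson_remove)
    then have "2 * (g * f * dyson S a) = F * g * (2 * (\<Prod>i\<in>S - {k}. (1 - X i * y) ^ a i))"
      by (simp only: F_def mult_ac)
    then show ?thesis by (simp only: eq)
  qed
  have xy: "X k * y = 1" unfolding y_def by (rule X_mult_X_inv)
  have F: "free_of k F" unfolding F_def by (intro free_of_mult f free_of_dyson) auto
  have P: "free_of k P" and Q: "free_of k Q"
    unfolding P_def Q_def by (intro exps_in_sum free_of_mult exps_in_of_nat free_of_X; simp)+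
  have y: "nonpos_in k y" unfolding y_def by (rule nonpos_in_X_inv)
  note np = free_of_imp_nonpos_in
  have "2 * CT (f * dyson S a) = CT (2 * (1 * f * dyson S a))" by (simp add: CT_numeral_mult)
  also have "2 * (1 * f * dyson S a) = 2 * F + y * (F * ((P * P - Q) * y + y * y * R - P - P))"
    unfolding D by (simp add: algebra_simps power2_eq_square power3_eq_cube)
  also have "CT \<dots> = 2 * CT F + 0"
    unfolding CT_add CT_numeral_mult y_def[symmetric]
    by (subst CT_nonpos_X_inv[of k, folded y_def])
      (intro nonpos_in_mult exps_in_diff exps_in_add np[OF F] np[OF P] np[OF Q] y R, rule refl)
  finally show "CT (f * dyson S a) = CT (f * dyson (S - {k}) a)" by (simp add: F_def)
  have "2 * CT (X k * f * dyson S a) = CT (2 * (X k * f * dyson S a))" by (simp add: CT_numeral_mult)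
  also have "2 * (X k * f * dyson S a) = 2 * (X k * F) - 2 * (X k * y) * (P * F)
      + (X k * y) * y * (F * (P * P - Q + y * R))"
    unfolding D by (simp add: algebra_simps power2_eq_square power3_eq_cube)
  also have "\<dots> = 2 * (X k * F) - 2 * (P * F) + y * (F * (P * P - Q + y * R))"
    by (simp add: xy)
  also have "CT \<dots> = 0 - 2 * CT (P * F) + 0"
    unfolding CT_add CT_diff CT_numeral_mult
    by (subst CT_nonpos_X_inv[of k, folded y_def])
      (intro nonpos_in_mult exps_in_diff exps_in_add np[OF F] np[OF P] np[OF Q] y R,
       simp add: CT_free_X[OF F])
  also have "P * F = (\<Sum>i\<in>S - {k}. of_nat (a i) * (X i * f * dyson (S - {k}) a))"
    unfolding P_def F_def sum_distrib_right by (simp only: mult_ac)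
  finally show "CT (X k * f * dyson S a)
      = - (\<Sum>i\<in>S - {k}. of_nat (a i) * CT (X i * f * dyson (S - {k}) a))"
    by (simp add: CT_sum CT_of_nat_mult)
  have "2 * CT (X k * X k * f * dyson S a) = CT (2 * (X k * X k * f * dyson S a))"
    by (simp add: CT_numeral_mult)
  also have "2 * (X k * X k * f * dyson S a) = 2 * (X k * X k * F) - 2 * (X k * y) * (X k * (P * F))
      + (X k * y) * (X k * y) * (P * P * F - Q * F) + (X k * y) * (X k * y) * (y * (F * R))"
    unfolding D by (simp add: algebra_simps power2_eq_square power3_eq_cube)
  also have "\<dots> = 2 * (X k * X k * F) - 2 * (X k * (P * F)) + (P * P * F - Q * F) + y * (F * R)"
    by (simp add: xy)
  also have "CT \<dots> = 0 - 0 + (CT (P * P * F) - CT (Q * F)) + 0"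
    unfolding CT_add CT_diff CT_numeral_mult
    by (subst CT_nonpos_X_inv[of k, folded y_def])
      (intro nonpos_in_mult np[OF F] R, simp add: CT_free_X_X[OF F] CT_free_X[OF free_of_mult[OF P F]])
  also have "P * P * F = (\<Sum>i\<in>S - {k}. \<Sum>j\<in>S - {k}. of_nat (a i) * (of_nat (a j) * (X i * X j * f * dyson (S - {k}) a)))"
    unfolding P_def F_def sum_product unfolding sum_distrib_right by (simp only: mult_ac)
  also have "Q * F = (\<Sum>i\<in>S - {k}. of_nat (a i) * (X i * X i * f * dyson (S - {k}) a))"
    unfolding Q_def F_def sum_distrib_right by (simp only: mult_ac)
  finally show "2 * CT (X k * X k * f * dyson S a)
      = (\<Sum>i\<in>S - {k}. \<Sum>j\<in>S - {k}. of_nat (a i) * of_nat (a j) * CT (X i * X j * f * dyson (S - {k}) a))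
        - (\<Sum>i\<in>S - {k}. of_nat (a i) * CT (X i * X i * f * dyson (S - {k}) a))"
    by (simp add: CT_sum CT_of_nat_mult mult.assoc)
qed

end

section \<open>Ratios to the multinomial coefficient\<close>

definition multinom :: "nat set \<Rightarrow> (nat \<Rightarrow> nat) \<Rightarrow> rat" where
  "multinom S a = fact (sum a S) / (\<Prod>i\<in>S. fact (a i))"

definition tot :: "nat set \<Rightarrow> (nat \<Rightarrow> nat) \<Rightarrow> rat" where
  "tot S a = of_nat (sum a S)"

lemma sum_decrement:
  fixes a :: "'i \<Rightarrow> nat"
  assumes "finite S" "k \<in> S" "a k > 0"
  shows "sum a S = Suc (sum (a(k := a k - 1)) S)"
  using assms by (simp add: sum.remove[of S k])

lemma tot_decrement:
  "finite S \<Longrightarrow> k \<in> S \<Longrightarrow> a k > 0 \<Longrightarrow> tot S (a(k := a k - 1)) = tot S a - 1"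
  using sum_decrement[of S k a] by (simp only: tot_def of_nat_Suc)

lemma tot_nonneg: "tot S a \<ge> 0"
  unfolding tot_def by (rule of_nat_0_le_iff)

lemma le_tot: "finite S \<Longrightarrow> i \<in> S \<Longrightarrow> of_nat (a i) \<le> tot S a"
  unfolding tot_def of_nat_le_iff by (intro member_le_sum) auto

lemma multinom_decrement:
  assumes "finite S" "k \<in> S" "a k > 0"
  shows "multinom S (a(k := a k - 1)) = of_nat (a k) / tot S a * multinom S a"
proof -
  define a' where "a' = a(k := a k - 1)"
  have sum: "sum a S = Suc (sum a' S)" unfolding a'_def using assms by (rule sum_decrement)
  then have "fact (sum a S) = tot S a * fact (sum a' S)" "tot S a > 0"
    by (simp_all only: tot_def fact_Suc of_nat_0_less_iff zero_less_Suc)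
  moreover have "(\<Prod>i\<in>S. fact (a i) :: rat) = of_nat (a k) * (\<Prod>i\<in>S. fact (a' i))"
    using assms by (simp add: a'_def prod.remove[of S k] fact_reduce)
  ultimately show ?thesis
    using assms(3) unfolding multinom_def a'_def[symmetric] by simp
qed

lemma multinom_drop: "finite S \<Longrightarrow> k \<in> S \<Longrightarrow> a k = 0 \<Longrightarrow> multinom (S - {k}) a = multinom S a"
  by (simp add: multinom_def sum.remove[of S k] prod.remove[of S k])

text \<open>
  If \<open>CT (f * dyson S a) = \<rho> a * multinom S a\<close>, then Good's recursion becomes a linear
  recursion for the ratio \<open>\<rho>\<close>, because lowering the exponent at \<open>k\<close> multiplies the multinomial
  coefficient by \<open>a k / tot S a\<close>. A ratio is called harmonic at \<open>a\<close> if it satisfies this recursion there.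
\<close>

definition harmonic :: "nat set \<Rightarrow> ((nat \<Rightarrow> nat) \<Rightarrow> rat) \<Rightarrow> (nat \<Rightarrow> nat) \<Rightarrow> bool" where
  "harmonic S \<rho> a \<longleftrightarrow> (\<Sum>k\<in>S. of_nat (a k) * \<rho> (a(k := a k - 1))) = tot S a * \<rho> a"

lemma harmonic_diff: "harmonic S \<rho> a \<Longrightarrow> harmonic S \<sigma> a \<Longrightarrow> harmonic S (\<lambda>a. \<rho> a - \<sigma> a) a"
  by (simp add: harmonic_def right_diff_distrib sum_subtractf)

lemma harmonic_scale: "harmonic S \<rho> a \<Longrightarrow> harmonic S (\<lambda>a. c * \<rho> a) a"
  by (simp add: harmonic_def sum_distrib_left[symmetric] mult.left_commute[of _ c])

lemma harmonic_sum:
  assumes "\<And>i. i \<in> A \<Longrightarrow> harmonic S (\<rho> i) a"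
  shows "harmonic S (\<lambda>a. \<Sum>i\<in>A. \<rho> i a) a"
proof -
  have "(\<Sum>k\<in>S. of_nat (a k) * (\<Sum>i\<in>A. \<rho> i (a(k := a k - 1))))
      = (\<Sum>i\<in>A. \<Sum>k\<in>S. of_nat (a k) * \<rho> i (a(k := a k - 1)))"
    unfolding sum_distrib_left by (rule sum.swap)
  also have "\<dots> = (\<Sum>i\<in>A. tot S a * \<rho> i a)"
    using assms by (simp add: harmonic_def)
  finally show ?thesis by (simp add: harmonic_def sum_distrib_left)
qed

text \<open>
  The inductive step of all three evaluations when every exponent is positive.
\<close>

lemma CT_by_recursion:
  assumes S: "finite S" "S \<noteq> {}" and pos: "\<And>i. i \<in> S \<Longrightarrow> a i > 0"
    and IH: "\<And>k. k \<in> S \<Longrightarrow>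
      CT (f * dyson S (a(k := a k - 1))) = \<rho> (a(k := a k - 1)) * multinom S (a(k := a k - 1))"
    and harm: "harmonic S \<rho> a"
  shows "CT (f * dyson S a) = \<rho> a * multinom S a"
proof -
  have tot: "tot S a > 0" unfolding tot_def of_nat_0_less_iff using S pos by (intro sum_pos)
  have rec: "(\<Sum>k\<in>S. dyson S (a(k := a k - 1))) = dyson S a"
    using S pos by (rule dyson_recursion)
  have "CT (f * dyson S a) = (\<Sum>k\<in>S. CT (f * dyson S (a(k := a k - 1))))"
    unfolding rec[symmetric] sum_distrib_left CT_sum ..
  also have "\<dots> = (\<Sum>k\<in>S. of_nat (a k) * \<rho> (a(k := a k - 1)) * (multinom S a / tot S a))"
    using S pos by (intro sum.cong refl) (simp only: IH multinom_decrement, simp)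
  also have "\<dots> = tot S a * \<rho> a * (multinom S a / tot S a)"
    using harm unfolding harmonic_def sum_distrib_right[symmetric] by simp
  finally show ?thesis using tot by simp
qed

section \<open>The harmonic ratios\<close>

text \<open>
  The quantity usually written \<open>a\<^sup>(\<^sup>r\<^sup>)\<close>.
\<close>

definition rest :: "nat set \<Rightarrow> nat \<Rightarrow> (nat \<Rightarrow> nat) \<Rightarrow> rat" where
  "rest S r a = tot (S - {r}) a"

lemma rest_nonneg: "rest S r a \<ge> 0"
  by (simp add: rest_def tot_nonneg)

lemma tot_eq_rest: "finite S \<Longrightarrow> r \<in> S \<Longrightarrow> tot S a = of_nat (a r) + rest S r a"
  by (simp add: rest_def tot_def sum.remove[of S r])

lemma rest_drop: "a k = 0 \<Longrightarrow> finite S \<Longrightarrow> rest (S - {k}) r a = rest S r a"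
  unfolding rest_def tot_def of_nat_eq_iff by (intro sum.mono_neutral_left) auto

lemma le_rest: "finite S \<Longrightarrow> i \<in> S \<Longrightarrow> i \<noteq> r \<Longrightarrow> of_nat (a i) \<le> rest S r a"
  unfolding rest_def by (rule le_tot) auto

lemma rest_decrement_self: "rest S r (a(r := c)) = rest S r a"
  by (simp add: rest_def tot_def)

lemma rest_decrement: "finite S \<Longrightarrow> k \<in> S \<Longrightarrow> k \<noteq> r \<Longrightarrow> a k > 0 \<Longrightarrow> rest S r (a(k := a k - 1)) = rest S r a - 1"
  unfolding rest_def by (rule tot_decrement) auto

definition linear_ratio :: "nat set \<Rightarrow> nat \<Rightarrow> (nat \<Rightarrow> nat) \<Rightarrow> rat" where
  "linear_ratio S r a = of_nat (a r) / (1 + rest S r a)"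

definition quadratic_scale :: "nat set \<Rightarrow> nat \<Rightarrow> (nat \<Rightarrow> nat) \<Rightarrow> rat" where
  "quadratic_scale S r a = of_nat (a r) * (tot S a + 1) / (2 + rest S r a)"

definition weight :: "nat set \<Rightarrow> nat \<Rightarrow> nat \<Rightarrow> (nat \<Rightarrow> nat) \<Rightarrow> rat" where
  "weight S r i a = 1 / (1 + rest S r a - of_nat (a i))"

text \<open>
  The value of \<open>CT (x\<^sub>s x\<^sub>t / x\<^sub>r\<^sup>2 D)\<close> relative to the multinomial coefficient. Every summand is
  harmonic in this form when all exponents are positive: since \<open>i\<close> differs from \<open>r\<close> and \<open>s\<close>, both
  \<open>a i\<close> and \<open>a s\<close> contribute to \<open>rest S r a\<close>, so the denominator of \<open>weight S r i\<close> stays positive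
  even after some exponent is lowered. For two variables the sum is empty, which is essential
  because that denominator could then become zero.
\<close>

definition quadratic_ratio :: "nat set \<Rightarrow> nat \<Rightarrow> nat \<Rightarrow> nat \<Rightarrow> (nat \<Rightarrow> nat) \<Rightarrow> rat" where
  "quadratic_ratio S r s t a = quadratic_scale S r a * ((of_nat (card S) - 1) / (1 + rest S r a)
     - (\<Sum>i\<in>S - {r, s, t}. weight S r i a)) - linear_ratio S r a"

text \<open>
  The second index \<open>s\<close> guarantees \<open>rest S r a \<ge> 1\<close>, so that the denominators stay positive after
  lowering an exponent.
\<close>

context
  fixes S :: "nat set" and r s :: nat and a :: "nat \<Rightarrow> nat"
  assumes fin: "finite S" and rS: "r \<in> S" and sS: "s \<in> S" and sr: "s \<noteq> r"
    and pos: "\<And>i. i \<in> S \<Longrightarrow> a i > 0"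
begin

lemma rest_ge_1: "rest S r a \<ge> 1"
proof -
  have "1 \<le> a s" using pos[OF sS] by simp
  then have "(1::rat) \<le> of_nat (a s)" by simp
  also have "\<dots> \<le> rest S r a" using fin sS sr by (rule le_rest)
  finally show ?thesis .
qed

lemma harmonic_linear_ratio: "harmonic S (linear_ratio S r) a"
proof -
  define b where "b = rest S r a"
  have b: "b \<ge> 1" unfolding b_def by (rule rest_ge_1)
  have "(\<Sum>k\<in>S. of_nat (a k) * linear_ratio S r (a(k := a k - 1)))
      = of_nat (a r) * ((of_nat (a r) - 1) / (1 + b)) + (\<Sum>k\<in>S - {r}. of_nat (a k) * (of_nat (a r) / b))"
    using fin rS pos unfolding sum.remove[OF fin rS]
    by (intro arg_cong2[of _ _ _ _ "(+)"] sum.cong refl)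
      (auto simp: linear_ratio_def rest_decrement_self rest_decrement b_def of_nat_diff Suc_le_eq simp del: One_nat_def)
  also have "(\<Sum>k\<in>S - {r}. of_nat (a k) * (of_nat (a r) / b)) = of_nat (a r)"
    using b unfolding sum_distrib_right[symmetric] by (simp add: b_def rest_def tot_def)
  also have "of_nat (a r) * ((of_nat (a r) - 1) / (1 + b)) + of_nat (a r)
      = (of_nat (a r) + b) * (of_nat (a r) / (1 + b))"
    using b by (simp add: field_simps)
  finally show ?thesis
    by (simp only: harmonic_def tot_eq_rest[OF fin rS] linear_ratio_def b_def)
qed

lemma harmonic_quadratic_scale: "harmonic S (\<lambda>a. quadratic_scale S r a / (1 + rest S r a)) a"
proof -
  define b where "b = rest S r a"
  define c :: rat where "c = of_nat (a r)"
  have b: "b \<ge> 1" unfolding b_def by (rule rest_ge_1)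
  have pred: "of_nat (a r - 1) = c - 1"
    using pos[OF rS] by (simp add: c_def of_nat_diff)
  have tot: "tot S a = c + b" unfolding b_def c_def by (rule tot_eq_rest[OF fin rS])
  have dec: "tot S (a(k := a k - 1)) = c + b - 1" if "k \<in> S" for k
    using tot_decrement[of S k a, OF fin that pos[OF that]] tot by simp
  have "(\<Sum>k\<in>S. of_nat (a k) * (quadratic_scale S r (a(k := a k - 1)) / (1 + rest S r (a(k := a k - 1)))))
      = c * ((c - 1) * (c + b) / (2 + b) / (1 + b)) + (\<Sum>k\<in>S - {r}. of_nat (a k) * (c * (c + b) / (1 + b) / b))"
    using fin rS pos unfolding sum.remove[OF fin rS]
    by (intro arg_cong2[of _ _ _ _ "(+)"] sum.cong refl)
      (auto simp: quadratic_scale_def rest_decrement_self rest_decrement b_def[symmetric] c_def[symmetric]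
        pred dec simp del: One_nat_def)
  also have "(\<Sum>k\<in>S - {r}. of_nat (a k) * (c * (c + b) / (1 + b) / b)) = c * (c + b) / (1 + b)"
    using b unfolding sum_distrib_right[symmetric] by (simp add: b_def rest_def tot_def)
  also have "c * ((c - 1) * (c + b) / (2 + b) / (1 + b)) + c * (c + b) / (1 + b)
      = (c + b) * (c * (c + b + 1) / (2 + b) / (1 + b))"
    using b by (simp add: divide_simps) algebra
  finally show ?thesis
    by (simp only: harmonic_def quadratic_scale_def tot c_def b_def)
qed

text \<open>
  Lowering \<open>a r\<close>, lowering \<open>a i\<close> and lowering another exponent change the denominators
  \<open>2 + b\<close> and \<open>1 + b - d\<close> differently, so the sum splits into three parts; in the last one the
  \<open>b - d\<close> from the sum of the exponents cancels the denominator \<open>b - d\<close>, which is positive because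
  of \<open>s\<close>.
\<close>

lemma harmonic_quadratic_scale_weight:
  assumes iS: "i \<in> S" and ir: "i \<noteq> r" and i_s: "i \<noteq> s"
  shows "harmonic S (\<lambda>a. quadratic_scale S r a * weight S r i a) a"
proof -
  define b where "b = rest S r a"
  define c :: rat where "c = of_nat (a r)"
  define d :: rat where "d = of_nat (a i)"
  have tot: "tot S a = c + b" unfolding b_def c_def by (rule tot_eq_rest[OF fin rS])
  have dec: "tot S (a(k := a k - 1)) = c + b - 1" if "k \<in> S" for k
    using tot_decrement[of S k a, OF fin that pos[OF that]] tot by simp
  have pred: "of_nat (a r - 1) = c - 1" "of_nat (a i - 1) = d - 1"
    using pos[OF rS] pos[OF iS] by (simp_all add: c_def d_def of_nat_diff)
  have iR: "i \<in> S - {r}" and fR: "finite (S - {r})" using iS ir fin by auto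
  have others: "(\<Sum>k\<in>S - {r} - {i}. of_nat (a k)) = b - d"
    unfolding b_def rest_def tot_def d_def of_nat_sum by (simp add: sum.remove[OF fR iR])
  have "of_nat (a s) \<le> (\<Sum>k\<in>S - {r} - {i}. of_nat (a k) :: rat)"
    using fin sS sr i_s by (intro member_le_sum) auto
  moreover have "(1::rat) \<le> of_nat (a s)" using pos[OF sS] by simp
  ultimately have bd: "b - d \<ge> 1" using others by simp
  have d: "d \<ge> 0" unfolding d_def by simp
  have "(\<Sum>k\<in>S. of_nat (a k) * (quadratic_scale S r (a(k := a k - 1)) * weight S r i (a(k := a k - 1))))
      = c * ((c - 1) * (c + b) / (2 + b) * (1 / (1 + b - d)))
      + (d * (c * (c + b) / (1 + b) * (1 / (1 + b - d)))
      + (\<Sum>k\<in>S - {r} - {i}. of_nat (a k) * (c * (c + b) / (1 + b) * (1 / (b - d)))))"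
    using fin rS pos iS ir unfolding sum.remove[OF fin rS] sum.remove[OF fR iR]
    by (intro arg_cong2[of _ _ _ _ "(+)"] sum.cong refl)
      (auto simp: quadratic_scale_def weight_def rest_decrement_self rest_decrement b_def[symmetric] c_def[symmetric]
        d_def[symmetric] pred dec simp del: One_nat_def)
  also have "(\<Sum>k\<in>S - {r} - {i}. of_nat (a k) * (c * (c + b) / (1 + b) * (1 / (b - d)))) = c * (c + b) / (1 + b)"
    using bd unfolding sum_distrib_right[symmetric] others by simp
  also have "c * ((c - 1) * (c + b) / (2 + b) * (1 / (1 + b - d)))
      + (d * (c * (c + b) / (1 + b) * (1 / (1 + b - d))) + c * (c + b) / (1 + b))
      = (c + b) * (c * (c + b + 1) / (2 + b) * (1 / (1 + b - d)))"
  proof -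
    have "2 + b \<noteq> 0" "1 + b \<noteq> 0" "1 + b - d \<noteq> 0" using bd d by auto
    then show ?thesis by (simp add: divide_simps) algebra
  qed
  finally show ?thesis
    by (simp only: harmonic_def quadratic_scale_def weight_def tot c_def b_def d_def)
qed

end

section \<open>Dyson's conjecture and the linear ratios of variables\<close>

text \<open>
  Dyson's conjecture. The constant ratio 1 is harmonic because the exponents add up to \<open>tot S a\<close>.
\<close>

theorem CT_dyson: "finite S \<Longrightarrow> CT (dyson S a) = multinom S a"
proof (induction S a rule: dyson_induct)
  case (empty a)
  show ?case by (simp add: dyson_def multinom_def CT_def)
next
  case (drop S a k)
  have "free_of k 1" by (simp add: exps_in_1)
  from CT_drop[of S k a 1, OF drop(1-3) this] drop show ?case by (simp add: multinom_drop)
next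
  case (decrease S a)
  have harm: "harmonic S (\<lambda>_. 1) a" by (simp add: harmonic_def tot_def)
  have IH: "CT (1 * dyson S (a(k := a k - 1))) = 1 * multinom S (a(k := a k - 1))" if "k \<in> S" for k
    using decrease.IH[OF that] by (simp only: mult_1)
  from decrease.hyps IH harm have "CT (1 * dyson S a) = 1 * multinom S a"
    by (rule CT_by_recursion)
  then show ?case by simp
qed

lemma linear_ratio_drop: "a k = 0 \<Longrightarrow> finite S \<Longrightarrow> linear_ratio (S - {k}) r a = linear_ratio S r a"
  by (simp add: linear_ratio_def rest_drop)

lemma sum_rest: "(\<Sum>i\<in>S - {r}. of_nat (a i)) = rest S r a"
  by (simp add: rest_def tot_def)

text \<open>
  The indices \<open>r\<close> and \<open>s\<close> vary in the induction: dropping \<open>s\<close> replaces \<open>x\<^sub>s\<close> by \<open>- \<Sum>i. a i x\<^sub>i\<close>, so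
  all ratios \<open>x\<^sub>i / x\<^sub>r\<close> are needed, and \<open>i = r\<close> gives Dyson's constant term.
\<close>

theorem CT_dyson_linear_ratio:
  assumes "finite S" "r \<in> S" "s \<in> S" "s \<noteq> r"
  shows "CT (X s * X_inv r * dyson S a) = - linear_ratio S r a * multinom S a"
  using assms
proof (induction S a arbitrary: r s rule: dyson_induct)
  case (empty a)
  then show ?case by simp
next
  case (drop S a k)
  note S = drop(1-3)
  consider "k = r" | "k = s" | "k \<noteq> r" "k \<noteq> s" by blast
  then show ?case
  proof cases
    case 1
    have "CT (X_inv k * X s * dyson S a) = 0"
      using drop.prems 1 by (intro CT_drop_X_inv S free_of_imp_nonpos_in free_of_X) simp
    then show ?thesis using 1 S(3) by (simp add: linear_ratio_def mult_ac)
  next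
    case 2
    define M where "M = multinom S a"
    define b where "b = rest S r a"
    have b: "b \<ge> 0" unfolding b_def by (rule rest_nonneg)
    have rT: "r \<in> S - {k}" and fT: "finite (S - {k})" using drop.prems 2 S by auto
    have "CT (X k * X_inv r * dyson S a)
        = - (\<Sum>i\<in>S - {k}. of_nat (a i) * CT (X i * X_inv r * dyson (S - {k}) a))"
      using drop.prems 2 by (intro CT_drop_X S free_of_X_inv) simp
    also have "(\<Sum>i\<in>S - {k}. of_nat (a i) * CT (X i * X_inv r * dyson (S - {k}) a))
        = of_nat (a r) * M + (\<Sum>i\<in>S - {k} - {r}. of_nat (a i) * (- linear_ratio S r a * M))"
      unfolding sum.remove[OF fT rT]
      using rT S drop.IH[OF rT]
      by (intro arg_cong2[of _ _ _ _ "(+)"] sum.cong refl)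
        (simp_all add: X_mult_X_inv CT_dyson M_def multinom_drop linear_ratio_drop)
    also have "(\<Sum>i\<in>S - {k} - {r}. of_nat (a i) * (- linear_ratio S r a * M)) = b * (- linear_ratio S r a * M)"
      unfolding sum_distrib_right[symmetric] sum_rest b_def rest_drop[of a k S r, OF S(3,1)] ..
    also have "- (of_nat (a r) * M + b * (- linear_ratio S r a * M)) = - linear_ratio S r a * M"
      using b unfolding linear_ratio_def b_def[symmetric] by (simp add: field_simps)
    finally show ?thesis using 2 by (simp add: M_def)
  next
    case 3
    have "CT (X s * X_inv r * dyson S a) = CT (X s * X_inv r * dyson (S - {k}) a)"
      using 3 by (intro CT_drop S free_of_mult free_of_X free_of_X_inv) auto
    also have "\<dots> = - linear_ratio (S - {k}) r a * multinom (S - {k}) a"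
      using drop.prems 3 by (intro drop.IH) auto
    finally show ?thesis by (simp only: linear_ratio_drop[of a k S, OF S(3,1)] multinom_drop[of S k a, OF S])
  qed
next
  case (decrease S a)
  have harm: "harmonic S (\<lambda>a. -1 * linear_ratio S r a) a"
    by (rule harmonic_scale, rule harmonic_linear_ratio) (fact decrease.prems decrease.hyps)+
  have IH: "CT (X s * X_inv r * dyson S (a(k := a k - 1)))
      = -1 * linear_ratio S r (a(k := a k - 1)) * multinom S (a(k := a k - 1))" if "k \<in> S" for k
    using decrease.IH[OF that decrease.prems] by (simp only: mult_minus1)
  have "CT (X s * X_inv r * dyson S a) = -1 * linear_ratio S r a * multinom S a"
    using decrease.hyps IH harm by (rule CT_by_recursion)
  then show ?case by simp
qed

section \<open>The quadratic ratios of variables\<close>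

text \<open>
  The part of \<open>quadratic_ratio S r s t a\<close> that does not depend on \<open>s\<close> and \<open>t\<close>.
\<close>

definition quadratic_base :: "nat set \<Rightarrow> nat \<Rightarrow> (nat \<Rightarrow> nat) \<Rightarrow> rat" where
  "quadratic_base S r a = - linear_ratio S r a
     - quadratic_scale S r a * (\<Sum>i\<in>S - {r}. of_nat (a i) * weight S r i a) / (1 + rest S r a)"

lemma weight_pole:
  assumes "finite S" "i \<in> S" "i \<noteq> r"
  shows "1 + rest S r a - of_nat (a i) \<noteq> 0"
  using le_rest[of S i r a, OF assms] by simp

text \<open>
  This form shows the dependence on \<open>s\<close> and \<open>t\<close>: apart from the diagonal it is additive, which
  is what makes the alternating sum collapse. It follows from
  \<open>1 / (1 + b) - weight S r i a = - a i * weight S r i a / (1 + b)\<close> with \<open>b = rest S r a\<close>.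
\<close>

lemma quadratic_ratio_eq_base:
  assumes S: "finite S" "r \<in> S" and s: "s \<in> S" "s \<noteq> r" and t: "t \<in> S" "t \<noteq> r"
  shows "quadratic_ratio S r s t a = quadratic_base S r a + quadratic_scale S r a * weight S r s a
      + (if s = t then 0 else quadratic_scale S r a * weight S r t a)"
proof -
  define b where "b = rest S r a"
  have b: "b \<ge> 0" unfolding b_def by (rule rest_nonneg)
  have "of_nat (card S) - 1 = (of_nat (card (S - {r})) :: rat)"
    using S by (simp add: card.remove[of S r] del: card_Diff_insert)
  then have "(of_nat (card S) - 1) / (1 + b) - (\<Sum>i\<in>S - {r}. weight S r i a)
      = (\<Sum>i\<in>S - {r}. 1 / (1 + b) - weight S r i a)"
    by (simp add: sum_subtractf)
  also have "\<dots> = (\<Sum>i\<in>S - {r}. of_nat (a i) * weight S r i a * (- 1 / (1 + b)))"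
  proof (intro sum.cong refl)
    fix i assume i: "i \<in> S - {r}"
    have "1 + b - of_nat (a i) \<noteq> 0" using i S weight_pole[of S i r a] by (simp add: b_def)
    moreover have "1 + b \<noteq> 0" using b by simp
    ultimately show "1 / (1 + b) - weight S r i a = of_nat (a i) * weight S r i a * (- 1 / (1 + b))"
      by (simp add: weight_def b_def[symmetric] divide_simps)
  qed
  also have "\<dots> = (\<Sum>i\<in>S - {r}. of_nat (a i) * weight S r i a) * (- 1 / (1 + b))"
    by (rule sum_distrib_right[symmetric])
  finally have U: "(of_nat (card S) - 1) / (1 + b) - (\<Sum>i\<in>S - {r}. weight S r i a)
      = - (\<Sum>i\<in>S - {r}. of_nat (a i) * weight S r i a) / (1 + b)"
    by simp
  have "(\<Sum>i\<in>S - {r}. weight S r i a) = (\<Sum>i\<in>S - {r, s, t}. weight S r i a)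
      + weight S r s a + (if s = t then 0 else weight S r t a)"
  proof (cases "s = t")
    case True
    have "S - {r, s, t} = S - {r} - {s}" using True by auto
    then show ?thesis using S s True by (simp add: sum.remove[of "S - {r}" s])
  next
    case False
    have "S - {r, s, t} = S - {r} - {s} - {t}" by auto
    then show ?thesis using S s t False
      by (simp add: sum.remove[of "S - {r}" s] sum.remove[of "S - {r} - {s}" t])
  qed
  with U have V: "(of_nat (card S) - 1) / (1 + b) - (\<Sum>i\<in>S - {r, s, t}. weight S r i a)
      = - (\<Sum>i\<in>S - {r}. of_nat (a i) * weight S r i a) / (1 + b)
      + weight S r s a + (if s = t then 0 else weight S r t a)"
    by linarith
  show ?thesis
    unfolding quadratic_ratio_def quadratic_base_def b_def[symmetric] V by (simp add: algebra_simps)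
qed

text \<open>
  The sum over \<open>j \<noteq> r\<close> that arises from replacing one variable by a weighted sum of the others. It
  is computed from \<open>a t * w t = (1 + b) * w t - 1\<close> with \<open>w t = weight S r t a\<close> and \<open>b = rest S r a\<close>.
\<close>

lemma sum_quadratic_ratio:
  assumes S: "finite S" "r \<in> S" and t: "t \<in> S" "t \<noteq> r"
  shows "(\<Sum>j\<in>S - {r}. of_nat (a j) * quadratic_ratio S r j t a) = rest S r a * quadratic_base S r a
    + quadratic_scale S r a * (\<Sum>i\<in>S - {r}. of_nat (a i) * weight S r i a)
    + quadratic_scale S r a - quadratic_scale S r a * weight S r t a"
proof -
  define K where "K = quadratic_scale S r a"
  define B where "B = quadratic_base S r a"
  define w where "w = (\<lambda>i. weight S r i a)"
  have tR: "t \<in> S - {r}" "finite (S - {r})" using S t by auto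
  have w: "of_nat (a t) * w t = (1 + rest S r a) * w t - 1"
    using weight_pole[of S t r a] S t by (simp add: w_def weight_def field_simps)
  have "(\<Sum>j\<in>S - {r}. of_nat (a j) * quadratic_ratio S r j t a)
      = (\<Sum>j\<in>S - {r}. of_nat (a j) * B + K * (of_nat (a j) * w j)
          + of_nat (a j) * (K * w t) - (if j = t then of_nat (a j) * (K * w t) else 0))"
    using S t by (intro sum.cong refl)
      (simp add: quadratic_ratio_eq_base K_def B_def w_def algebra_simps)
  also have "\<dots> = rest S r a * B + K * (\<Sum>j\<in>S - {r}. of_nat (a j) * w j)
      + rest S r a * (K * w t) - of_nat (a t) * (K * w t)"
    using tR by (simp add: sum.distrib sum_subtractf sum_distrib_right[symmetric]
        sum_distrib_left[symmetric] sum_rest)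
  also have "of_nat (a t) * (K * w t) = K * ((1 + rest S r a) * w t - 1)"
    unfolding w[symmetric] by (simp add: mult_ac)
  finally show ?thesis by (simp add: K_def B_def w_def algebra_simps)
qed

context
  fixes S :: "nat set" and k :: nat and a :: "nat \<Rightarrow> nat"
  assumes fin: "finite S" and k: "k \<in> S" and ak: "a k = 0"
begin

lemma tot_drop: "tot (S - {k}) a = tot S a"
  unfolding tot_def of_nat_eq_iff using fin k ak by (simp add: sum.remove[of S k])

lemma quadratic_scale_drop: "quadratic_scale (S - {k}) r a = quadratic_scale S r a"
  using fin ak by (simp add: quadratic_scale_def tot_drop rest_drop)

lemma weight_drop: "weight (S - {k}) r i a = weight S r i a"
  using fin ak by (simp add: weight_def rest_drop)

lemma quadratic_base_drop: "quadratic_base (S - {k}) r a = quadratic_base S r a"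
proof -
  have "(\<Sum>i\<in>S - {k} - {r}. of_nat (a i) * weight S r i a) = (\<Sum>i\<in>S - {r}. of_nat (a i) * weight S r i a)"
    using fin ak by (intro sum.mono_neutral_left) auto
  then show ?thesis
    using fin ak by (simp add: quadratic_base_def linear_ratio_drop quadratic_scale_drop weight_drop rest_drop)
qed

end

lemma quadratic_ratio_commute: "quadratic_ratio S r s t a = quadratic_ratio S r t s a"
  by (simp add: quadratic_ratio_def insert_commute)

lemma quadratic_scale_eq:
  assumes "finite S" "r \<in> S"
  shows "quadratic_scale S r a * (2 + rest S r a) = of_nat (a r) * (of_nat (a r) + rest S r a + 1)"
  using rest_nonneg[of S r a] by (simp add: quadratic_scale_def tot_eq_rest[OF assms])

text \<open>
  Agreement of the formula with the effect of dropping \<open>k\<close> from \<open>x\<^sub>k x\<^sub>t / x\<^sub>r\<^sup>2\<close>. The summand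
  with \<open>a r * linear_ratio S r a\<close> is the contribution of \<open>x\<^sub>r x\<^sub>t / x\<^sub>r\<^sup>2\<close>.
\<close>

lemma quadratic_ratio_drop_single:
  assumes S: "finite S" "k \<in> S" "a k = 0" and r: "r \<in> S" "r \<noteq> k" and t: "t \<in> S" "t \<noteq> k" "t \<noteq> r"
  shows "- (of_nat (a r) * (- linear_ratio S r a)
      + (\<Sum>j\<in>S - {k} - {r}. of_nat (a j) * quadratic_ratio (S - {k}) r j t a)) = quadratic_ratio S r k t a"
proof -
  define b where "b = rest S r a"
  define K where "K = quadratic_scale S r a"
  define W where "W = (\<Sum>i\<in>S - {r}. of_nat (a i) * weight S r i a)"
  define A :: rat where "A = of_nat (a r)"
  have b: "1 + b \<noteq> 0" using rest_nonneg[of S r a] by (simp add: b_def)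
  have W: "(\<Sum>i\<in>S - {k} - {r}. of_nat (a i) * weight S r i a) = W"
    unfolding W_def using S by (intro sum.mono_neutral_left) auto
  have K: "K * (2 + b) = A * (A + b + 1)"
    unfolding K_def b_def A_def using S r by (intro quadratic_scale_eq)
  have "(\<Sum>j\<in>S - {k} - {r}. of_nat (a j) * quadratic_ratio (S - {k}) r j t a)
      = b * quadratic_base S r a + K * W + K - K * weight S r t a"
    using sum_quadratic_ratio[of "S - {k}" r t a] S r t
    by (simp add: rest_drop quadratic_base_drop quadratic_scale_drop weight_drop W b_def K_def)
  moreover have "quadratic_ratio S r k t a = quadratic_base S r a + K * (1 / (1 + b)) + K * weight S r t a"
    using S r t by (subst quadratic_ratio_eq_base) (auto simp: K_def b_def weight_def)
  moreover have "quadratic_base S r a = (- A - K * W) / (1 + b)"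
    by (simp add: quadratic_base_def linear_ratio_def K_def W_def A_def b_def diff_divide_distrib)
  then have "quadratic_base S r a * (1 + b) = - A - K * W"
    using b by simp
  moreover have "A * A / (1 + b) + A = K + K * (1 / (1 + b))"
    using b K by (simp add: field_simps)
  moreover have "linear_ratio S r a = A / (1 + b)" by (simp add: linear_ratio_def A_def b_def)
  ultimately show ?thesis by (simp add: A_def[symmetric] algebra_simps)
qed

text \<open>
  Agreement of the formula with the effect of dropping \<open>k\<close> from \<open>x\<^sub>k\<^sup>2 / x\<^sub>r\<^sup>2\<close>. The terms without a
  sum are the contributions of \<open>x\<^sub>r\<^sup>2 / x\<^sub>r\<^sup>2\<close> and of \<open>x\<^sub>r x\<^sub>i / x\<^sub>r\<^sup>2\<close>. After elimination of
  \<open>quadratic_base\<close> the two sides differ by a multiple of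
  \<open>K * (2 + b) - A * (A + b + 1)\<close>, which is zero by the definition of \<open>K\<close>.
\<close>

lemma quadratic_ratio_drop_double:
  assumes S: "finite S" "k \<in> S" "a k = 0" and r: "r \<in> S" "r \<noteq> k"
  shows "of_nat (a r) * (of_nat (a r) - 1) - 2 * of_nat (a r) * rest S r a * linear_ratio S r a
    + (\<Sum>i\<in>S - {k} - {r}. of_nat (a i) * (\<Sum>j\<in>S - {k} - {r}. of_nat (a j) * quadratic_ratio (S - {k}) r j i a))
    - (\<Sum>i\<in>S - {k} - {r}. of_nat (a i) * quadratic_ratio (S - {k}) r i i a) = 2 * quadratic_ratio S r k k a"
proof -
  define b where "b = rest S r a"
  define K where "K = quadratic_scale S r a"
  define W where "W = (\<Sum>i\<in>S - {r}. of_nat (a i) * weight S r i a)"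
  define A :: rat where "A = of_nat (a r)"
  define B where "B = quadratic_base S r a"
  have b: "1 + b \<noteq> 0" using rest_nonneg[of S r a] by (simp add: b_def)
  have W: "(\<Sum>i\<in>S - {k} - {r}. of_nat (a i) * weight S r i a) = W"
    unfolding W_def using S by (intro sum.mono_neutral_left) auto
  have N: "(\<Sum>i\<in>S - {k} - {r}. of_nat (a i)) = b"
    unfolding sum_rest b_def using S by (simp add: rest_drop)
  have K: "K * (2 + b) = A * (A + b + 1)"
    unfolding K_def b_def A_def using S r by (intro quadratic_scale_eq)
  have "(\<Sum>i\<in>S - {k} - {r}. of_nat (a i) * (\<Sum>j\<in>S - {k} - {r}. of_nat (a j) * quadratic_ratio (S - {k}) r j i a))
      = (\<Sum>i\<in>S - {k} - {r}. of_nat (a i) * (b * B + K * W + K) - K * (of_nat (a i) * weight S r i a))"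
  proof (intro sum.cong refl)
    fix i assume "i \<in> S - {k} - {r}"
    then have "(\<Sum>j\<in>S - {k} - {r}. of_nat (a j) * quadratic_ratio (S - {k}) r j i a)
        = b * B + K * W + K - K * weight S r i a"
      using sum_quadratic_ratio[of "S - {k}" r i a] S r
      by (simp add: rest_drop quadratic_base_drop quadratic_scale_drop weight_drop W b_def K_def B_def)
    then show "of_nat (a i) * (\<Sum>j\<in>S - {k} - {r}. of_nat (a j) * quadratic_ratio (S - {k}) r j i a)
        = of_nat (a i) * (b * B + K * W + K) - K * (of_nat (a i) * weight S r i a)"
      by (simp only: right_diff_distrib mult.left_commute)
  qed
  also have "\<dots> = b * (b * B + K * W + K) - K * W"
    by (simp add: sum_subtractf sum_distrib_right[symmetric] sum_distrib_left[symmetric] N W)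
  finally have 1: "(\<Sum>i\<in>S - {k} - {r}. of_nat (a i) * (\<Sum>j\<in>S - {k} - {r}. of_nat (a j) * quadratic_ratio (S - {k}) r j i a))
      = b * (b * B + K * W + K) - K * W" .
  have "(\<Sum>i\<in>S - {k} - {r}. of_nat (a i) * quadratic_ratio (S - {k}) r i i a)
      = (\<Sum>i\<in>S - {k} - {r}. of_nat (a i) * B + K * (of_nat (a i) * weight S r i a))"
    using S r by (intro sum.cong refl)
      (simp add: quadratic_ratio_eq_base quadratic_base_drop quadratic_scale_drop weight_drop B_def K_def algebra_simps)
  also have "\<dots> = b * B + K * W"
    by (simp add: sum.distrib sum_distrib_right[symmetric] sum_distrib_left[symmetric] N W)
  finally have 2: "(\<Sum>i\<in>S - {k} - {r}. of_nat (a i) * quadratic_ratio (S - {k}) r i i a) = b * B + K * W" .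
  have 3: "quadratic_ratio S r k k a = B + K / (1 + b)"
    using S r by (subst quadratic_ratio_eq_base) (auto simp: K_def b_def B_def weight_def)
  have B: "B = - A / (1 + b) - K * W / (1 + b)"
    by (simp add: B_def quadratic_base_def linear_ratio_def K_def W_def A_def b_def)
  have "A * (A - 1) - 2 * A * b * (A / (1 + b)) + (b * (b * B + K * W + K) - K * W) - (b * B + K * W)
      - 2 * (B + K / (1 + b)) = (b - 1) * (K * (2 + b) - A * (A + b + 1)) / (1 + b)"
    unfolding B using b by (simp add: divide_simps) algebra
  then show ?thesis
    unfolding 1 2 3 linear_ratio_def A_def[symmetric] b_def[symmetric] K by simp
qed

text \<open>
  Dropping \<open>r\<close> gives zero, since \<open>x\<^sub>r\<close> then occurs only with negative exponents; dropping \<open>s\<close> or \<open>t\<close>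
  leads back to the two previous evaluations and to this one with fewer variables.
\<close>

theorem CT_dyson_quadratic_ratio:
  assumes "finite S" "r \<in> S" "s \<in> S" "s \<noteq> r" "t \<in> S" "t \<noteq> r"
  shows "CT (X s * X t * (X_inv r * X_inv r) * dyson S a) = quadratic_ratio S r s t a * multinom S a"
  using assms
proof (induction S a arbitrary: r s t rule: dyson_induct)
  case (empty a)
  then show ?case by simp
next
  case (drop S a k)
  note S = drop(1-3)
  define T where "T = S - {k}"
  define M where "M = multinom S a"
  have fT: "finite T" and MT: "multinom T a = M"
    using S by (simp_all add: T_def M_def multinom_drop)
  \<comment> \<open>The coefficients left by dropping \<open>k\<close> also involve \<open>x\<^sub>r\<close>, which cancels against \<open>1 / x\<^sub>r\<^sup>2\<close>.\<close>
  have rr: "CT (X r * X r * (X_inv r * X_inv r) * dyson T a) = M"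
  proof -
    have "X r * X r * (X_inv r * X_inv r) * dyson T a = (X r * X_inv r) * ((X r * X_inv r) * dyson T a)"
      by (simp only: mult_ac)
    then show ?thesis using fT by (simp only: X_mult_X_inv mult_1 CT_dyson MT)
  qed
  have ri: "CT (X r * X i * (X_inv r * X_inv r) * dyson T a) = - linear_ratio S r a * M"
      "CT (X i * X r * (X_inv r * X_inv r) * dyson T a) = - linear_ratio S r a * M"
    if "i \<in> T - {r}" "r \<in> T" for i
  proof -
    have "X r * X i * (X_inv r * X_inv r) * dyson T a = (X r * X_inv r) * (X i * X_inv r * dyson T a)"
      by (simp only: mult_ac)
    then show "CT (X r * X i * (X_inv r * X_inv r) * dyson T a) = - linear_ratio S r a * M"
      using fT that CT_dyson_linear_ratio[of T r i a] linear_ratio_drop[of a k S r, OF S(3,1)]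
      by (simp only: X_mult_X_inv mult_1 MT T_def[symmetric]) simp
    then show "CT (X i * X r * (X_inv r * X_inv r) * dyson T a) = - linear_ratio S r a * M"
      by (simp only: mult.commute[of "X i"])
  qed
  have ij: "CT (X i * X j * (X_inv r * X_inv r) * dyson T a) = quadratic_ratio T r i j a * M"
    if "i \<in> T - {r}" "j \<in> T - {r}" "r \<in> T" for i j
    using that drop.IH[of r i j] by (simp add: T_def[symmetric] MT)
  have single: "CT (X k * X j * (X_inv r * X_inv r) * dyson S a) = quadratic_ratio S r k j a * M"
    if r: "r \<noteq> k" and j: "j \<in> S" "j \<noteq> r" "j \<noteq> k" for j
  proof -
    have rT: "r \<in> T" and jT: "j \<in> T - {r}" using drop.prems r j by (auto simp: T_def)
    have "CT (X k * X j * (X_inv r * X_inv r) * dyson S a)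
        = CT (X k * (X j * (X_inv r * X_inv r)) * dyson S a)" by (simp only: mult_ac)
    also have "\<dots> = - (\<Sum>i\<in>T. of_nat (a i) * CT (X i * (X j * (X_inv r * X_inv r)) * dyson T a))"
      unfolding T_def using r j by (intro CT_drop_X S free_of_mult free_of_X free_of_X_inv) auto
    also have "(\<Sum>i\<in>T. of_nat (a i) * CT (X i * (X j * (X_inv r * X_inv r)) * dyson T a))
        = (\<Sum>i\<in>T. of_nat (a i) * CT (X i * X j * (X_inv r * X_inv r) * dyson T a))"
      by (simp only: mult.assoc)
    also have "\<dots> = of_nat (a r) * (- linear_ratio S r a * M)
        + (\<Sum>i\<in>T - {r}. of_nat (a i) * (quadratic_ratio T r i j a * M))"
      unfolding sum.remove[OF fT rT]
      using ri(1)[OF jT rT] ij[OF _ jT rT]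
      by (intro arg_cong2[of _ _ _ _ "(+)"] sum.cong refl) (simp_all only:)
    also have "- \<dots> = - (of_nat (a r) * (- linear_ratio S r a)
        + (\<Sum>i\<in>T - {r}. of_nat (a i) * quadratic_ratio T r i j a)) * M"
      by (simp add: algebra_simps sum_distrib_left)
    also have "\<dots> = quadratic_ratio S r k j a * M"
      unfolding T_def using S drop.prems r j by (subst quadratic_ratio_drop_single) auto
    finally show ?thesis .
  qed
  have double: "CT (X k * X k * (X_inv r * X_inv r) * dyson S a) = quadratic_ratio S r k k a * M"
    if r: "r \<noteq> k"
  proof -
    have rT: "r \<in> T" using drop.prems r by (auto simp: T_def)
    have ij: "CT (X i * X j * (X_inv r * X_inv r) * dyson T a) = quadratic_ratio T r j i a * M"
      if "i \<in> T - {r}" "j \<in> T - {r}" for i j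
      using ij[OF that rT] quadratic_ratio_commute[of T r i j a] by (simp only:)
    let ?B = "\<lambda>i j. CT (X i * X j * (X_inv r * X_inv r) * dyson T a)"
    have "2 * CT (X k * X k * (X_inv r * X_inv r) * dyson S a)
        = (\<Sum>i\<in>T. \<Sum>j\<in>T. of_nat (a i) * of_nat (a j) * ?B i j) - (\<Sum>i\<in>T. of_nat (a i) * ?B i i)"
      unfolding T_def using r by (intro CT_drop_X_X S free_of_mult free_of_X_inv) auto
    also have "(\<Sum>i\<in>T. \<Sum>j\<in>T. of_nat (a i) * of_nat (a j) * ?B i j)
        = (\<Sum>i\<in>T. of_nat (a i) * (\<Sum>j\<in>T. of_nat (a j) * ?B i j))"
      by (simp only: sum_distrib_left mult.assoc)
    also have "\<dots> = of_nat (a r) * (of_nat (a r) * M + (\<Sum>j\<in>T - {r}. of_nat (a j) * (- linear_ratio S r a * M)))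
        + (\<Sum>i\<in>T - {r}. of_nat (a i) * (of_nat (a r) * (- linear_ratio S r a * M)
            + (\<Sum>j\<in>T - {r}. of_nat (a j) * (quadratic_ratio T r j i a * M))))"
      by (simp only: sum.remove[OF fT rT] rr ri[OF _ rT] ij cong: sum.cong)
    also have "(\<Sum>i\<in>T. of_nat (a i) * ?B i i)
        = of_nat (a r) * M + (\<Sum>i\<in>T - {r}. of_nat (a i) * (quadratic_ratio T r i i a * M))"
      by (simp only: sum.remove[OF fT rT] rr ij cong: sum.cong)
    also have "of_nat (a r) * (of_nat (a r) * M + (\<Sum>j\<in>T - {r}. of_nat (a j) * (- linear_ratio S r a * M)))
        + (\<Sum>i\<in>T - {r}. of_nat (a i) * (of_nat (a r) * (- linear_ratio S r a * M)
            + (\<Sum>j\<in>T - {r}. of_nat (a j) * (quadratic_ratio T r j i a * M))))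
        - (of_nat (a r) * M + (\<Sum>i\<in>T - {r}. of_nat (a i) * (quadratic_ratio T r i i a * M)))
        = (of_nat (a r) * (of_nat (a r) - 1) - 2 * of_nat (a r) * rest S r a * linear_ratio S r a
          + (\<Sum>i\<in>T - {r}. of_nat (a i) * (\<Sum>j\<in>T - {r}. of_nat (a j) * quadratic_ratio T r j i a))
          - (\<Sum>i\<in>T - {r}. of_nat (a i) * quadratic_ratio T r i i a)) * M"
    proof -
      have N: "(\<Sum>j\<in>T - {r}. of_nat (a j)) = rest S r a"
        unfolding sum_rest T_def using S by (simp add: rest_drop)
      have *: "(\<Sum>j\<in>T - {r}. of_nat (a j) * (h j * M)) = (\<Sum>j\<in>T - {r}. of_nat (a j) * h j) * M" for h
        by (simp add: sum_distrib_right mult.assoc)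
      show ?thesis
        unfolding * distrib_left sum.distrib mult.assoc[symmetric] sum_distrib_right[symmetric] N
        by (simp add: algebra_simps)
    qed
    also have "\<dots> = 2 * quadratic_ratio S r k k a * M"
      unfolding T_def using S drop.prems r by (subst quadratic_ratio_drop_double) auto
    finally show ?thesis by simp
  qed
  consider "k = r" | "k \<noteq> r" "k = s" "s = t" | "k \<noteq> r" "k = s" "s \<noteq> t" | "k \<noteq> r" "k = t" "s \<noteq> t"
    | "k \<noteq> r" "k \<noteq> s" "k \<noteq> t" by blast
  then show ?case
  proof cases
    case 1
    have "CT (X_inv k * (X_inv k * (X s * X t)) * dyson S a) = 0"
      using drop.prems 1
      by (intro CT_drop_X_inv S nonpos_in_mult nonpos_in_X_inv free_of_imp_nonpos_in free_of_X) auto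
    then show ?thesis using 1 S(3) by (simp add: quadratic_ratio_def linear_ratio_def quadratic_scale_def mult_ac)
  next
    case 2
    then show ?thesis using double by (simp add: M_def)
  next
    case 3
    then show ?thesis using single[of t] drop.prems by (simp add: M_def)
  next
    case 4
    then have "CT (X t * X s * (X_inv r * X_inv r) * dyson S a) = quadratic_ratio S r t s a * M"
      using single[of s] drop.prems by simp
    then show ?thesis by (simp only: M_def mult.commute[of "X t" "X s"] quadratic_ratio_commute[of S r t])
  next
    case 5
    have "CT (X s * X t * (X_inv r * X_inv r) * dyson S a)
        = CT (X s * X t * (X_inv r * X_inv r) * dyson T a)"
      unfolding T_def using 5 by (intro CT_drop S free_of_mult free_of_X free_of_X_inv) auto
    also have "\<dots> = quadratic_ratio T r s t a * M"
      using 5 drop.prems by (intro ij) (auto simp: T_def)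
    also have "quadratic_ratio T r s t a = quadratic_ratio S r s t a"
      using S drop.prems 5 by (simp add: T_def quadratic_ratio_eq_base quadratic_base_drop quadratic_scale_drop weight_drop)
    finally show ?thesis by (simp add: M_def)
  qed
next
  case (decrease S a)
  have harm: "harmonic S (quadratic_ratio S r s t) a"
  proof -
    have "harmonic S (\<lambda>a. (of_nat (card S) - 1) * (quadratic_scale S r a / (1 + rest S r a))
        - (\<Sum>i\<in>S - {r, s, t}. quadratic_scale S r a * weight S r i a) - linear_ratio S r a) a"
      using decrease.hyps decrease.prems
      by (intro harmonic_diff harmonic_sum harmonic_scale harmonic_quadratic_scale[of S r s]
          harmonic_linear_ratio[of S r s] harmonic_quadratic_scale_weight[of S r s]) auto
    moreover have "quadratic_ratio S r s t = (\<lambda>a. (of_nat (card S) - 1) * (quadratic_scale S r a / (1 + rest S r a))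
        - (\<Sum>i\<in>S - {r, s, t}. quadratic_scale S r a * weight S r i a) - linear_ratio S r a)"
      by (simp add: fun_eq_iff quadratic_ratio_def right_diff_distrib sum_distrib_left mult_ac)
    ultimately show ?thesis by (simp only:)
  qed
  have "CT (X s * X t * (X_inv r * X_inv r) * dyson S (a(k := a k - 1)))
      = quadratic_ratio S r s t (a(k := a k - 1)) * multinom S (a(k := a k - 1))" if "k \<in> S" for k
    using that decrease.prems by (rule decrease.IH)
  from decrease.hyps this harm show ?case by (rule CT_by_recursion)
qed

section \<open>Alternating quadratic forms\<close>

lemma sum_alternating: "(\<Sum>j = 1..2 * m. (-1) ^ j) = (0 :: 'a::comm_ring_1)"
  by (induction m) simp_all

text \<open>
  An additive kernel \<open>B + w i + w j\<close> is annihilated by signs that sum to zero; only the missing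
  \<open>w i\<close> on the diagonal survives.
\<close>

lemma signed_double_sum:
  fixes e w :: "'i \<Rightarrow> 'a::comm_ring_1"
  assumes fin: "finite J" and zero: "(\<Sum>j\<in>J. e j) = 0" and sq: "\<And>j. j \<in> J \<Longrightarrow> e j * e j = 1"
  shows "(\<Sum>i\<in>J. \<Sum>j\<in>J. e i * (e j * (B + w i + (if i = j then 0 else w j)))) = - (\<Sum>j\<in>J. w j)"
proof -
  define E where "E = (\<Sum>j\<in>J. e j * w j)"
  have row: "(\<Sum>j\<in>J. e i * (e j * (B + w i + (if i = j then 0 else w j)))) = e i * E - w i" if i: "i \<in> J" for i
  proof -
    have "(\<Sum>j\<in>J. e i * (e j * (B + w i + (if i = j then 0 else w j))))
        = (\<Sum>j\<in>J. e i * (B + w i) * e j + e i * (e j * w j) - (if i = j then e i * e i * w i else 0))"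
      by (rule sum.cong[OF refl]) (simp add: algebra_simps)
    also have "\<dots> = e i * (B + w i) * (\<Sum>j\<in>J. e j) + e i * E - e i * e i * w i"
      using fin i by (simp add: sum_subtractf sum.distrib E_def sum_distrib_left)
    finally show ?thesis by (simp add: zero sq i)
  qed
  have "(\<Sum>i\<in>J. \<Sum>j\<in>J. e i * (e j * (B + w i + (if i = j then 0 else w j)))) = (\<Sum>i\<in>J. e i * E - w i)"
    by (rule sum.cong[OF refl row])
  also have "\<dots> = (\<Sum>i\<in>J. e i) * E - (\<Sum>i\<in>J. w i)"
    by (simp only: sum_subtractf sum_distrib_right)
  finally show ?thesis by (simp add: zero)
qed

theorem corollary3p2:
  fixes n m r :: nat and a :: "nat \<Rightarrow> nat" and I :: "nat set" and idx :: "nat \<Rightarrow> nat"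
  assumes I: "I \<subseteq> {1..n}"
    and idx: "bij_betw idx {1..2 * m} I"
    and r: "1 \<le> r" "r \<le> n" "r \<notin> I"
  shows "CT ((\<Sum>j = 1..2 * m. (-1) ^ j * X (idx j)) ^ 2 * X_inv r ^ 2 * dyson_product n a) =
    - (of_nat (a r) * (total_exp n a + 1) / (2 + total_except n a r)) *
      (\<Sum>j\<in>I. 1 / (1 + total_except n a r - of_nat (a j))) * dyson_const n a"
proof -
  define S where "S = {1..n}"
  define J where "J = {1..2 * m}"
  define w where "w = (\<lambda>j. quadratic_scale S r a * weight S r (idx j) a * multinom S a)"
  define B where "B = quadratic_base S r a * multinom S a"
  define e :: "nat \<Rightarrow> rat" where "e = (\<lambda>j. (-1) ^ j)"
  have S: "finite S" "r \<in> S" using r by (simp_all add: S_def)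
  have idxS: "idx j \<in> S" "idx j \<noteq> r" if "j \<in> J" for j
  proof -
    have "idx j \<in> I" using bij_betwE[OF idx] that unfolding J_def by (rule bspec)
    then show "idx j \<in> S" "idx j \<noteq> r" using I r(3) unfolding S_def by blast+
  qed
  have sign: "CT ((-1) ^ j * f) = e j * CT f" for j f
    unfolding e_def by (cases "even j") (simp_all add: CT_uminus)
  have ratio: "CT (X (idx i) * X (idx j) * (X_inv r * X_inv r) * dyson S a)
      = B + w i + (if i = j then 0 else w j)" if ij: "i \<in> J" "j \<in> J" for i j
  proof -
    have "idx i = idx j \<longleftrightarrow> i = j"
      using inj_on_eq_iff[OF bij_betw_imp_inj_on[OF idx]] ij unfolding J_def by blast
    then show ?thesis
      unfolding CT_dyson_quadratic_ratio[OF S idxS[OF ij(1)] idxS[OF ij(2)]]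
        quadratic_ratio_eq_base[OF S idxS[OF ij(1)] idxS[OF ij(2)]]
      by (simp add: B_def w_def distrib_right)
  qed
  have "(\<Sum>j\<in>J. (-1) ^ j * X (idx j)) ^ 2 * X_inv r ^ 2 * dyson S a
      = (\<Sum>i\<in>J. \<Sum>j\<in>J. (-1) ^ i * ((-1) ^ j * (X (idx i) * X (idx j) * (X_inv r * X_inv r) * dyson S a)))"
    unfolding power2_eq_square sum_product unfolding sum_distrib_right by (simp only: mult_ac)
  then have "CT ((\<Sum>j\<in>J. (-1) ^ j * X (idx j)) ^ 2 * X_inv r ^ 2 * dyson S a)
      = (\<Sum>i\<in>J. \<Sum>j\<in>J. e i * (e j * (B + w i + (if i = j then 0 else w j))))"
    by (simp only: CT_sum sign ratio cong: sum.cong)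
  moreover have "\<dots> = - (\<Sum>j\<in>J. w j)"
  proof (rule signed_double_sum)
    show "(\<Sum>j\<in>J. e j) = 0" unfolding J_def e_def by (rule sum_alternating)
  qed (simp_all add: J_def e_def flip: power_mult_distrib)
  moreover have "(\<Sum>j\<in>J. w j) = quadratic_scale S r a * (\<Sum>j\<in>I. weight S r j a) * multinom S a"
    unfolding w_def J_def sum_distrib_left sum_distrib_right using idx by (rule sum.reindex_bij_betw)
  moreover have "total_exp n a = tot S a" by (simp add: total_exp_def tot_def S_def)
  moreover have "total_except n a r = rest S r a"
    using tot_eq_rest[OF S, of a] by (simp add: total_except_def total_exp_def tot_def S_def)
  moreover have "dyson_const n a = multinom S a"
    by (simp add: dyson_const_def multinom_def S_def)
  ultimately show ?thesis
    unfolding dyson_product_eq_dyson S_def[symmetric] J_def[symmetric]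
    by (simp add: quadratic_scale_def weight_def)
qed

end
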